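(* Let $a<b$ be real numbers and let $f:I=[a,b]\longrightarrow\mathbb{R}$ be absolutely continuous on $I$. Then $$f(b)-f(a)=\int_a^b f'(x)\,dx,$$ where the integral is taken in Lebesgue's sense.
   Context: A function $f:[a,b]\to\mathbb{R}$ is absolutely continuous on $[a,b]$ if for every $\varepsilon>0$ there exists $\delta>0$ such that, whenever $\{(a_j,b_j)\}_{j=1}^n$ is a (finite) family of pairwise disjoint subintervals of $[a,b]$ satisfying $\sum_{j=1}^n (b_j-a_j)<\delta$, one has $\sum_{j=1}^n |f(b_j)-f(a_j)|<\varepsilon$. By classical results, which are taken as known, an absolutely continuous $f$ has a finite derivative $f'(x)$ for almost every $x\in I$ (with respect to Lebesgue measure) and $f'\in L^1(I)$, so the integral in the claim makes sense, $f'$ being the almost everywhere defined derivative of $f$. *)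

theory Defs
  imports "HOL-Analysis.Analysis"
begin

text \<open>
  The library's \<^const>\<open>absolutely_continuous\<close> is the unrelated relation between measures.
  Disjointness is that of the open intervals \<open>(u j, v j)\<close>, so neighbouring intervals may share
  an endpoint. Only the values of \<open>f\<close> on \<open>[a, b]\<close> are constrained.
\<close>

definition absolutely_continuous_fun :: "real \<Rightarrow> real \<Rightarrow> (real \<Rightarrow> real) \<Rightarrow> bool" where
  "absolutely_continuous_fun a b f \<longleftrightarrow>
    (\<forall>\<epsilon>>0. \<exists>\<delta>>0. \<forall>(n::nat) (u::nat \<Rightarrow> real) (v::nat \<Rightarrow> real).
      (\<forall>j<n. a \<le> u j \<and> u j < v j \<and> v j \<le> b) \<and>
      disjoint_family_on (\<lambda>j. {u j<..<v j}) {..<n} \<and>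
      (\<Sum>j<n. v j - u j) < \<delta>
      \<longrightarrow> (\<Sum>j<n. \<bar>f (v j) - f (u j)\<bar>) < \<epsilon>)"

end

theory Submission
  imports Defs
begin

text \<open>
  An absolutely continuous \<open>f\<close> is an indefinite integral, and an indefinite integral is
  differentiable almost everywhere with the integrand as its derivative. The two facts together
  give the almost everywhere differentiability of \<open>f\<close>, the integrability of the derivative and the
  formula.

  For the first fact, write \<open>f = P - (P - f)\<close> with \<open>P\<close> the positive variation of \<open>f\<close>. Both parts are
  nondecreasing, and \<open>P\<close> inherits absolute continuity: if \<open>S\<close> is a family of intervals of small
  total length, the increments of \<open>P\<close> over \<open>S\<close> are approximated by increments of \<open>f\<close> over a refinement
  of \<open>S\<close>, which has no greater total length
  (\<open>absolutely_continuous_positive_variation\<close>). A nondecreasing absolutely continuous function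
  defines a Stieltjes measure on \<open>[a, b]\<close>. A Lebesgue null set is covered by nonoverlapping
  intervals of small total length, so its Stieltjes measure is zero
  (\<open>absolutely_continuous_mono_null_set\<close>), and the Radon-Nikodym theorem provides the integrand
  (\<open>absolutely_continuous_mono_is_indefinite_integral\<close>).

  The second fact is Lebesgue's differentiation theorem in one dimension. It rests on the
  observation that a finite measure \<open>N\<close> vanishing on \<open>A\<close> has derivative zero at almost every point of
  \<open>A\<close> (\<open>AE_small_balls_of_null_set\<close>), by Vitali's covering theorem and outer regularity. For a
  rational \<open>q\<close> this applies to the measure with density \<open>max 0 (h - q)\<close>, which vanishes on \<open>{h \<le> q}\<close>:
  there the difference quotients of the integral of \<open>h\<close> are eventually at most \<open>q\<close> plus an arbitrarily
  small error. Letting \<open>q\<close> decrease to \<open>h x\<close>, and repeating the argument for \<open>- h\<close>, identifies the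
  derivative.
\<close>

section \<open>Families of nonoverlapping intervals\<close>

text \<open>
  A set of pairs of endpoints replaces an enumeration, so that refining a family or cutting it at
  a point needs no reindexing. As \<open>fst p < snd p\<close> is required, families that live in
  nonoverlapping intervals share no pair, which lets sums over their unions split.
\<close>

definition interval_family :: "real \<Rightarrow> real \<Rightarrow> (real \<times> real) set \<Rightarrow> bool" where
  "interval_family a b S \<longleftrightarrow> finite S \<and> (\<forall>p\<in>S. a \<le> fst p \<and> fst p < snd p \<and> snd p \<le> b) \<and>
     pairwise (\<lambda>p q. disjnt {fst p<..<snd p} {fst q<..<snd q}) S"

definition increment :: "(real \<Rightarrow> real) \<Rightarrow> (real \<times> real) set \<Rightarrow> real" where
  "increment f S = (\<Sum>p\<in>S. f (snd p) - f (fst p))"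

lemma interval_familyD:
  assumes "interval_family a b S" "p \<in> S"
  shows "a \<le> fst p" "fst p < snd p" "snd p \<le> b"
  using assms by (auto simp: interval_family_def)

lemma interval_family_finite: "interval_family a b S \<Longrightarrow> finite S"
  by (simp add: interval_family_def)

lemma interval_family_empty [simp]: "interval_family a b {}"
  by (simp add: interval_family_def)

lemma interval_family_singleton: "a \<le> u \<Longrightarrow> u < v \<Longrightarrow> v \<le> b \<Longrightarrow> interval_family a b {(u, v)}"
  by (simp add: interval_family_def)

lemma interval_family_mono:
  "interval_family c d S \<Longrightarrow> a \<le> c \<Longrightarrow> d \<le> b \<Longrightarrow> interval_family a b S"
  by (fastforce simp: interval_family_def)

lemma disjnt_greaterThanLessThan_iff:
  fixes a b c d :: real
  assumes "a < b" "c < d"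
  shows "disjnt {a<..<b} {c<..<d} \<longleftrightarrow> b \<le> c \<or> d \<le> a"
proof
  assume *: "disjnt {a<..<b} {c<..<d}"
  show "b \<le> c \<or> d \<le> a"
  proof (rule ccontr)
    assume "\<not> (b \<le> c \<or> d \<le> a)"
    then have "max a c < min b d" using assms by auto
    then obtain z where "max a c < z" "z < min b d" using dense by blast
    with * show False by (auto simp: disjnt_iff)
  qed
qed (auto simp: disjnt_iff)

lemma interval_family_pairwise:
  assumes "interval_family a b S" "p \<in> S" "q \<in> S" "p \<noteq> q"
  shows "snd p \<le> fst q \<or> snd q \<le> fst p"
  using assms disjnt_greaterThanLessThan_iff[of "fst p" "snd p" "fst q" "snd q"]
  by (auto simp: interval_family_def pairwise_def)

lemma interval_familyI:
  assumes "finite S" "\<And>p. p \<in> S \<Longrightarrow> a \<le> fst p \<and> fst p < snd p \<and> snd p \<le> b"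
    and "\<And>p q. p \<in> S \<Longrightarrow> q \<in> S \<Longrightarrow> p \<noteq> q \<Longrightarrow> snd p \<le> fst q \<or> snd q \<le> fst p"
  shows "interval_family a b S"
  using assms unfolding interval_family_def pairwise_def
  by (metis disjnt_greaterThanLessThan_iff)

lemma increment_empty [simp]: "increment f {} = 0"
  by (simp add: increment_def)

lemma increment_singleton [simp]: "increment f {(u, v)} = f v - f u"
  by (simp add: increment_def)

text \<open>
  Refinement: replacing each member by a family inside it gives a family again.
\<close>

lemma interval_family_UN:
  assumes S: "interval_family a b S"
    and T: "\<And>p. p \<in> S \<Longrightarrow> interval_family (fst p) (snd p) (T p)"
  shows "interval_family a b (\<Union>p\<in>S. T p)"
    and "increment f (\<Union>p\<in>S. T p) = (\<Sum>p\<in>S. increment f (T p))"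
proof -
  show "interval_family a b (\<Union>p\<in>S. T p)"
  proof (rule interval_familyI)
    show "finite (\<Union>p\<in>S. T p)" using assms interval_family_finite by blast
  next
    fix r assume "r \<in> (\<Union>p\<in>S. T p)"
    then obtain p where "p \<in> S" "r \<in> T p" by blast
    with interval_familyD[OF S, of p] interval_familyD[OF T, of p r]
    show "a \<le> fst r \<and> fst r < snd r \<and> snd r \<le> b" by auto
  next
    fix r s assume "r \<in> (\<Union>p\<in>S. T p)" "s \<in> (\<Union>p\<in>S. T p)" "r \<noteq> s"
    then obtain p q where pq: "p \<in> S" "r \<in> T p" "q \<in> S" "s \<in> T q" by blast
    show "snd r \<le> fst s \<or> snd s \<le> fst r"
    proof (cases "p = q")
      case True
      then show ?thesis using pq \<open>r \<noteq> s\<close> interval_family_pairwise[OF T[OF pq(1)], of r s] by simp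
    next
      case False
      with interval_family_pairwise[OF S pq(1,3)] have "snd p \<le> fst q \<or> snd q \<le> fst p" by simp
      with interval_familyD[OF T[OF pq(1)] pq(2)] interval_familyD[OF T[OF pq(3)] pq(4)]
      show ?thesis by linarith
    qed
  qed
  have "T p \<inter> T q = {}" if "p \<in> S" "q \<in> S" "p \<noteq> q" for p q
  proof -
    have False if "r \<in> T p" "r \<in> T q" for r
      using interval_familyD[OF T[OF \<open>p \<in> S\<close>] that(1)] interval_familyD[OF T[OF \<open>q \<in> S\<close>] that(2)]
        interval_family_pairwise[OF S \<open>p \<in> S\<close> \<open>q \<in> S\<close> \<open>p \<noteq> q\<close>] by linarith
    then show ?thesis by blast
  qed
  then show "increment f (\<Union>p\<in>S. T p) = (\<Sum>p\<in>S. increment f (T p))"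
    unfolding increment_def
    using interval_family_finite[OF S] interval_family_finite[OF T] by (subst sum.UNION_disjoint) auto
qed

lemma interval_family_Un:
  assumes S: "interval_family a x S" and T: "interval_family x b T" and "a \<le> x" "x \<le> b"
  shows "interval_family a b (S \<union> T)" and "increment f (S \<union> T) = increment f S + increment f T"
proof -
  show "interval_family a b (S \<union> T)"
  proof (rule interval_familyI)
    show "finite (S \<union> T)" using S T by (simp add: interval_family_finite)
    show "a \<le> fst p \<and> fst p < snd p \<and> snd p \<le> b" if "p \<in> S \<union> T" for p
      using that
    proof
      assume "p \<in> S"
      from interval_familyD[OF S this] show ?thesis using \<open>x \<le> b\<close> by linarith
    next
      assume "p \<in> T"
      from interval_familyD[OF T this] show ?thesis using \<open>a \<le> x\<close> by linarith
    qed
    show "snd p \<le> fst q \<or> snd q \<le> fst p" if "p \<in> S \<union> T" "q \<in> S \<union> T" "p \<noteq> q" for p q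
    proof -
      consider "p \<in> S" "q \<in> S" | "p \<in> T" "q \<in> T" | "snd p \<le> x" "x \<le> fst q" | "snd q \<le> x" "x \<le> fst p"
        using \<open>p \<in> S \<union> T\<close> \<open>q \<in> S \<union> T\<close> interval_familyD(3)[OF S] interval_familyD(1)[OF T] by blast
      then show ?thesis
      proof cases
        case 1
        then show ?thesis using interval_family_pairwise[OF S _ _ that(3)] by simp
      next
        case 2
        then show ?thesis using interval_family_pairwise[OF T _ _ that(3)] by simp
      qed linarith+
    qed
  qed
  have False if "p \<in> S" "p \<in> T" for p
    using interval_familyD[OF S that(1)] interval_familyD[OF T that(2)] by linarith
  then have "S \<inter> T = {}" by blast
  then show "increment f (S \<union> T) = increment f S + increment f T"
    unfolding increment_def using S T by (intro sum.union_disjoint) (auto dest: interval_family_finite)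
qed

text \<open>
  Cutting at \<open>x\<close>: a member that straddles \<open>x\<close> is divided there, and the two increments add up to
  the original one, because the value of the function at \<open>x\<close> cancels.
\<close>

lemma increment_split:
  assumes S: "interval_family a b S" and x: "a \<le> x" "x \<le> b"
  obtains S1 S2 where "interval_family a x S1" "interval_family x b S2"
    "\<And>f. increment f S = increment f S1 + increment f S2"
proof -
  define l where "l p = (min (fst p) x, min (snd p) x)" for p :: "real \<times> real"
  define r where "r p = (max (fst p) x, max (snd p) x)" for p :: "real \<times> real"
  define L where "L = {p\<in>S. fst p < x}"
  define R where "R = {p\<in>S. x < snd p}"
  \<comment> \<open>Clipping keeps members apart; those clipped to a point are left out of \<open>L\<close> and \<open>R\<close>, which
     makes clipping injective and does not change the sums, as their increment is zero.\<close>
  have sepL: "snd (l p) \<le> fst (l q) \<or> snd (l q) \<le> fst (l p)"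
    and sepR: "snd (r p) \<le> fst (r q) \<or> snd (r q) \<le> fst (r p)" if "p \<in> S" "q \<in> S" "p \<noteq> q" for p q
    using interval_family_pairwise[OF S that] by (auto simp: l_def r_def)
  have ndL: "fst (l p) < snd (l p)" if "p \<in> L" for p
    using that interval_familyD[OF S, of p] by (auto simp: L_def l_def)
  have ndR: "fst (r p) < snd (r p)" if "p \<in> R" for p
    using that interval_familyD[OF S, of p] by (auto simp: R_def r_def)
  have inj: "inj_on l L" "inj_on r R"
    using sepL sepR ndL ndR unfolding inj_on_def L_def R_def
    by (metis (no_types, lifting) linorder_not_less mem_Collect_eq)+
  have fin: "finite S" using S by (rule interval_family_finite)
  have "interval_family a x (l ` L)"
  proof (rule interval_familyI)
    show "finite (l ` L)" using fin by (simp add: L_def)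
    show "a \<le> fst p \<and> fst p < snd p \<and> snd p \<le> x" if "p \<in> l ` L" for p
      using that ndL interval_familyD[OF S] x by (auto simp: L_def l_def)
    show "snd p \<le> fst q \<or> snd q \<le> fst p" if "p \<in> l ` L" "q \<in> l ` L" "p \<noteq> q" for p q
      using that sepL unfolding L_def by blast
  qed
  moreover have "interval_family x b (r ` R)"
  proof (rule interval_familyI)
    show "finite (r ` R)" using fin by (simp add: R_def)
    show "x \<le> fst p \<and> fst p < snd p \<and> snd p \<le> b" if "p \<in> r ` R" for p
      using that ndR interval_familyD[OF S] x by (auto simp: R_def r_def)
    show "snd p \<le> fst q \<or> snd q \<le> fst p" if "p \<in> r ` R" "q \<in> r ` R" "p \<noteq> q" for p q
      using that sepR unfolding R_def by blast
  qed
  moreover have "increment f S = increment f (l ` L) + increment f (r ` R)" for f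
  proof -
    have "increment f (l ` L) = (\<Sum>p\<in>L. f (snd (l p)) - f (fst (l p)))"
      unfolding increment_def by (simp add: sum.reindex[OF inj(1)])
    also have "\<dots> = (\<Sum>p\<in>S. f (snd (l p)) - f (fst (l p)))"
      using fin interval_familyD(2)[OF S]
      by (intro sum.mono_neutral_left) (force simp: L_def l_def)+
    finally have 1: "increment f (l ` L) = \<dots>" .
    have "increment f (r ` R) = (\<Sum>p\<in>R. f (snd (r p)) - f (fst (r p)))"
      unfolding increment_def by (simp add: sum.reindex[OF inj(2)])
    also have "\<dots> = (\<Sum>p\<in>S. f (snd (r p)) - f (fst (r p)))"
      using fin interval_familyD(2)[OF S]
      by (intro sum.mono_neutral_left) (force simp: R_def r_def)+
    finally have 2: "increment f (r ` R) = \<dots>" .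
    show ?thesis
      unfolding 1 2 sum.distrib[symmetric] unfolding increment_def
      using interval_familyD(2)[OF S]
      by (intro sum.cong) (auto simp: l_def r_def min_def max_def)
  qed
  ultimately show ?thesis by (rule that)
qed

lemma increment_id_eq_measure:
  assumes S: "interval_family a b S"
  shows "increment (\<lambda>x. x) S = measure lborel (\<Union>p\<in>S. {fst p<..<snd p})"
proof -
  have "increment (\<lambda>x. x) S = (\<Sum>p\<in>S. measure lborel {fst p<..<snd p})"
    unfolding increment_def
    by (intro sum.cong refl) (simp add: less_imp_le interval_familyD(2)[OF S])
  also have "\<dots> = measure lborel (\<Union>p\<in>S. {fst p<..<snd p})"
  proof (rule measure_finite_Union[symmetric])
    show "disjoint_family_on (\<lambda>p. {fst p<..<snd p}) S"
      using S unfolding interval_family_def pairwise_def disjoint_family_on_def disjnt_def by blast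
    show "emeasure lborel {fst p<..<snd p} \<noteq> \<infinity>" if "p \<in> S" for p
      using interval_familyD(2)[OF S that] by simp
  qed (auto simp: interval_family_finite[OF S])
  finally show ?thesis .
qed

lemma increment_id_le:
  assumes S: "interval_family a b S" and "a \<le> b"
  shows "increment (\<lambda>x. x) S \<le> b - a"
proof -
  have "increment (\<lambda>x. x) S \<le> measure lborel {a..b}"
    unfolding increment_id_eq_measure[OF S]
  proof (rule measure_mono_fmeasurable)
    show "(\<Union>p\<in>S. {fst p<..<snd p}) \<subseteq> {a..b}"
    proof clarify
      fix p :: "real \<times> real" and x assume "p \<in> S" "x \<in> {fst p<..<snd p}"
      with interval_familyD[OF S \<open>p \<in> S\<close>] show "x \<in> {a..b}" by simp
    qed
    show "(\<Union>p\<in>S. {fst p<..<snd p}) \<in> sets lborel"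
      by (simp add: open_UN borel_open)
  qed (auto simp: fmeasurable_def emeasure_lborel_Icc_eq)
  then show ?thesis using \<open>a \<le> b\<close> by simp
qed

text \<open>
  The translation between enumerated intervals and sets of pairs is possible because distinct
  indices carry disjoint nonempty intervals, hence distinct pairs.
\<close>

lemma absolutely_continuous_fun_iff:
  "absolutely_continuous_fun a b f \<longleftrightarrow>
     (\<forall>\<epsilon>>0. \<exists>\<delta>>0. \<forall>S. interval_family a b S \<and> increment (\<lambda>x. x) S < \<delta> \<longrightarrow>
        (\<Sum>p\<in>S. \<bar>f (snd p) - f (fst p)\<bar>) < \<epsilon>)"
  (is "_ \<longleftrightarrow> ?R")
proof
  assume f: "absolutely_continuous_fun a b f"
  show ?R
  proof (intro allI impI)
    fix \<epsilon> :: real assume "\<epsilon> > 0"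
    then obtain \<delta> where "\<delta> > 0" and \<delta>: "\<And>(n::nat) u v. (\<forall>j<n. a \<le> u j \<and> u j < v j \<and> v j \<le> b) \<and>
      disjoint_family_on (\<lambda>j. {u j<..<v j}) {..<n} \<and>
      (\<Sum>j<n. v j - u j) < \<delta> \<Longrightarrow> (\<Sum>j<n. \<bar>f (v j) - f (u j)\<bar>) < \<epsilon>"
      using f[unfolded absolutely_continuous_fun_def, rule_format, of \<epsilon>] by blast
    have "(\<Sum>p\<in>S. \<bar>f (snd p) - f (fst p)\<bar>) < \<epsilon>"
      if S: "interval_family a b S" and len: "increment (\<lambda>x. x) S < \<delta>" for S
    proof -
      obtain h where h: "bij_betw h {..<card S} S"
        using ex_bij_betw_nat_finite[OF interval_family_finite[OF S]] by (auto simp: atLeast0LessThan)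
      have hS: "h j \<in> S" if "j < card S" for j using h that by (auto simp: bij_betw_def)
      have "(\<Sum>j<card S. \<bar>f (snd (h j)) - f (fst (h j))\<bar>) < \<epsilon>"
      proof (intro \<delta> conjI)
        show "\<forall>j<card S. a \<le> fst (h j) \<and> fst (h j) < snd (h j) \<and> snd (h j) \<le> b"
          using hS interval_familyD[OF S] by blast
        show "disjoint_family_on (\<lambda>j. {fst (h j)<..<snd (h j)}) {..<card S}"
          unfolding disjoint_family_on_def
        proof (intro ballI impI)
          fix i j assume "i \<in> {..<card S}" "j \<in> {..<card S}" "i \<noteq> j"
          then have "h i \<noteq> h j" "h i \<in> S" "h j \<in> S"
            using h hS by (auto simp: bij_betw_def inj_on_def)
          with S show "{fst (h i)<..<snd (h i)} \<inter> {fst (h j)<..<snd (h j)} = {}"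
            unfolding interval_family_def pairwise_def disjnt_def by blast
        qed
        show "(\<Sum>j<card S. snd (h j) - fst (h j)) < \<delta>"
          using len sum.reindex_bij_betw[OF h, of "\<lambda>p. snd p - fst p"] by (simp add: increment_def)
      qed
      then show ?thesis
        using sum.reindex_bij_betw[OF h, of "\<lambda>p. \<bar>f (snd p) - f (fst p)\<bar>"] by simp
    qed
    then show "\<exists>\<delta>>0. \<forall>S. interval_family a b S \<and> increment (\<lambda>x. x) S < \<delta> \<longrightarrow>
        (\<Sum>p\<in>S. \<bar>f (snd p) - f (fst p)\<bar>) < \<epsilon>"
      using \<open>\<delta> > 0\<close> by blast
  qed
next
  assume R: ?R
  show "absolutely_continuous_fun a b f"
    unfolding absolutely_continuous_fun_def
  proof (intro allI impI)
    fix \<epsilon> :: real assume "\<epsilon> > 0"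
    with R obtain \<delta> where "\<delta> > 0" and \<delta>: "\<And>S. interval_family a b S \<Longrightarrow> increment (\<lambda>x. x) S < \<delta> \<Longrightarrow>
        (\<Sum>p\<in>S. \<bar>f (snd p) - f (fst p)\<bar>) < \<epsilon>" by blast
    have "(\<Sum>j<n. \<bar>f (v j) - f (u j)\<bar>) < \<epsilon>"
      if uv: "\<forall>j<n. a \<le> u j \<and> u j < v j \<and> v j \<le> b" "disjoint_family_on (\<lambda>j. {u j<..<v j}) {..<n}"
        "(\<Sum>j<n. v j - u j) < \<delta>" for n :: nat and u v
    proof -
      define h where "h j = (u j, v j)" for j
      have sep: "v i \<le> u j \<or> v j \<le> u i" if "i < n" "j < n" "i \<noteq> j" for i j
        using uv that disjnt_greaterThanLessThan_iff[of "u i" "v i" "u j" "v j"]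
        by (auto simp: disjoint_family_on_def disjnt_def)
      have inj: "inj_on h {..<n}"
      proof (rule inj_onI, rule ccontr)
        fix i j assume ij: "i \<in> {..<n}" "j \<in> {..<n}" "h i = h j" "i \<noteq> j"
        then have "v i \<le> u j \<or> v j \<le> u i" "u i < v i" using sep uv(1) by auto
        with \<open>h i = h j\<close> show False by (auto simp: h_def)
      qed
      have "(\<Sum>p\<in>h ` {..<n}. \<bar>f (snd p) - f (fst p)\<bar>) < \<epsilon>"
      proof (rule \<delta>)
        show "interval_family a b (h ` {..<n})"
        proof (rule interval_familyI)
          show "a \<le> fst p \<and> fst p < snd p \<and> snd p \<le> b" if "p \<in> h ` {..<n}" for p
            using that uv(1) by (auto simp: h_def)
          show "snd p \<le> fst q \<or> snd q \<le> fst p" if pq: "p \<in> h ` {..<n}" "q \<in> h ` {..<n}" "p \<noteq> q" for p q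
          proof -
            obtain i j where "i < n" "j < n" "p = h i" "q = h j" using pq(1,2) by blast
            moreover have "i \<noteq> j" using \<open>p = h i\<close> \<open>q = h j\<close> pq(3) by blast
            ultimately show ?thesis using sep[of i j] by (simp add: h_def)
          qed
        qed simp
        show "increment (\<lambda>x. x) (h ` {..<n}) < \<delta>"
          using uv(3) by (simp add: increment_def sum.reindex[OF inj] o_def) (simp add: h_def)
      qed
      then show ?thesis by (simp add: sum.reindex[OF inj] o_def) (simp add: h_def)
    qed
    then show "\<exists>\<delta>>0. \<forall>(n::nat) u v. (\<forall>j<n. a \<le> u j \<and> u j < v j \<and> v j \<le> b) \<and>
      disjoint_family_on (\<lambda>j. {u j<..<v j}) {..<n} \<and> (\<Sum>j<n. v j - u j) < \<delta>
      \<longrightarrow> (\<Sum>j<n. \<bar>f (v j) - f (u j)\<bar>) < \<epsilon>"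
      using \<open>\<delta> > 0\<close> by blast
  qed
qed

lemma absolutely_continuous_funE:
  assumes "absolutely_continuous_fun a b f" "\<epsilon> > 0"
  obtains \<delta> where "\<delta> > 0" "\<And>S. interval_family a b S \<Longrightarrow> increment (\<lambda>x. x) S < \<delta> \<Longrightarrow>
      (\<Sum>p\<in>S. \<bar>f (snd p) - f (fst p)\<bar>) < \<epsilon>"
  using assms(1)[unfolded absolutely_continuous_fun_iff, rule_format, OF assms(2)] by blast

lemma absolutely_continuous_fun_diff:
  assumes "absolutely_continuous_fun a b f" "absolutely_continuous_fun a b g"
  shows "absolutely_continuous_fun a b (\<lambda>x. f x - g x)"
  unfolding absolutely_continuous_fun_iff
proof (intro allI impI)
  fix \<epsilon> :: real assume "\<epsilon> > 0"
  then have "\<epsilon>/2 > 0" by simp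
  obtain d1 where "d1 > 0"
    and 1: "\<And>S. interval_family a b S \<Longrightarrow> increment (\<lambda>x. x) S < d1 \<Longrightarrow> (\<Sum>p\<in>S. \<bar>f (snd p) - f (fst p)\<bar>) < \<epsilon>/2"
    using absolutely_continuous_funE[OF assms(1) \<open>\<epsilon>/2 > 0\<close>] by blast
  obtain d2 where "d2 > 0"
    and 2: "\<And>S. interval_family a b S \<Longrightarrow> increment (\<lambda>x. x) S < d2 \<Longrightarrow> (\<Sum>p\<in>S. \<bar>g (snd p) - g (fst p)\<bar>) < \<epsilon>/2"
    using absolutely_continuous_funE[OF assms(2) \<open>\<epsilon>/2 > 0\<close>] by blast
  have "(\<Sum>p\<in>S. \<bar>f (snd p) - g (snd p) - (f (fst p) - g (fst p))\<bar>) < \<epsilon>"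
    if "interval_family a b S" "increment (\<lambda>x. x) S < min d1 d2" for S
  proof -
    have "(\<Sum>p\<in>S. \<bar>f (snd p) - g (snd p) - (f (fst p) - g (fst p))\<bar>)
      \<le> (\<Sum>p\<in>S. \<bar>f (snd p) - f (fst p)\<bar> + \<bar>g (snd p) - g (fst p)\<bar>)"
      by (intro sum_mono) linarith
    then show ?thesis using 1[of S] 2[of S] that by (simp add: sum.distrib)
  qed
  then show "\<exists>\<delta>>0. \<forall>S. interval_family a b S \<and> increment (\<lambda>x. x) S < \<delta> \<longrightarrow>
      (\<Sum>p\<in>S. \<bar>f (snd p) - g (snd p) - (f (fst p) - g (fst p))\<bar>) < \<epsilon>"
    using \<open>d1 > 0\<close> \<open>d2 > 0\<close> by (intro exI[of _ "min d1 d2"] conjI allI impI) simp_all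
qed

lemma increment_le_sum_abs: "increment f S \<le> (\<Sum>p\<in>S. \<bar>f (snd p) - f (fst p)\<bar>)"
  unfolding increment_def by (intro sum_mono) simp

section \<open>The Jordan decomposition of an absolutely continuous function\<close>

text \<open>
  Bounded variation: choose \<open>\<delta>\<close> for \<open>\<epsilon> = 1\<close> and cut \<open>[a, b]\<close> into finitely many pieces shorter than
  \<open>\<delta>\<close>. Each piece contributes at most \<open>1\<close>.
\<close>

lemma absolutely_continuous_fun_increment_bounded:
  assumes "absolutely_continuous_fun a b f"
  obtains B where "\<And>S. interval_family a b S \<Longrightarrow> increment f S \<le> B"
proof -
  obtain \<delta> where "\<delta> > 0" and \<delta>: "\<And>S. interval_family a b S \<Longrightarrow> increment (\<lambda>x. x) S < \<delta> \<Longrightarrow>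
        (\<Sum>p\<in>S. \<bar>f (snd p) - f (fst p)\<bar>) < 1"
    using absolutely_continuous_funE[OF assms zero_less_one] by blast
  have short: "increment f S \<le> 1" if "interval_family x y S" "a \<le> x" "x \<le> y" "y \<le> b" "y - x \<le> \<delta>/2" for x y S
  proof -
    have "interval_family a b S" using interval_family_mono that by blast
    moreover have "increment (\<lambda>x. x) S < \<delta>"
      using increment_id_le[OF that(1,3)] that(5) \<open>\<delta> > 0\<close> by linarith
    ultimately show ?thesis using \<delta> increment_le_sum_abs[of f S] by fastforce
  qed
  \<comment> \<open>Each induction step cuts one piece of length at most \<open>\<delta>/2\<close> off the right end.\<close>
  have bound: "increment f S \<le> real (Suc n)"
    if "interval_family x y S" "a \<le> x" "x \<le> y" "y \<le> b" "y - x \<le> real (Suc n) * (\<delta>/2)" for x y S n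
    using that
  proof (induction n arbitrary: y S)
    case 0
    then show ?case using short[of x y S] by simp
  next
    case (Suc n)
    define z where "z = max x (y - \<delta>/2)"
    have z: "x \<le> z" "z \<le> y" using Suc.prems \<open>\<delta> > 0\<close> by (auto simp: z_def)
    obtain S1 S2 where S12: "interval_family x z S1" "interval_family z y S2"
      "\<And>f. increment f S = increment f S1 + increment f S2"
      using increment_split[OF Suc.prems(1) z] by blast
    have "y - x \<le> real (Suc n) * (\<delta>/2) + \<delta>/2" using Suc.prems(5) by (simp add: field_simps)
    moreover have "0 \<le> real (Suc n) * (\<delta>/2)" using \<open>\<delta> > 0\<close> by simp
    ultimately have "z - x \<le> real (Suc n) * (\<delta>/2)" by (simp add: z_def max_def)
    then have "increment f S1 \<le> real (Suc n)"
      using Suc.prems z by (intro Suc.IH[OF S12(1)]) auto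
    moreover have "increment f S2 \<le> 1"
    proof (rule short[OF S12(2)])
      have "y - \<delta>/2 \<le> z" by (simp add: z_def)
      then show "y - z \<le> \<delta>/2" by linarith
    qed (use Suc.prems z in auto)
    ultimately show ?case by (simp add: S12(3)[of f])
  qed
  obtain n :: nat where n: "b - a \<le> real n * (\<delta>/2)"
    using reals_Archimedean3[of "\<delta>/2"] \<open>\<delta> > 0\<close> by (meson half_gt_zero less_imp_le)
  have "increment f S \<le> real (Suc n)" if "interval_family a b S" for S
  proof (cases "a \<le> b")
    case True
    have "real n * (\<delta>/2) \<le> real (Suc n) * (\<delta>/2)" using \<open>\<delta> > 0\<close> by (simp add: field_simps)
    with n show ?thesis using bound[OF that order_refl True order_refl, of n] by linarith
  next
    case False
    then have "S = {}" using interval_familyD[OF that] by fastforce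
    then show ?thesis by simp
  qed
  then show ?thesis by (rule that)
qed

text \<open>
  Signed increments suffice: a supremum over all families may omit the intervals on which \<open>f\<close>
  decreases.
\<close>

definition positive_variation :: "(real \<Rightarrow> real) \<Rightarrow> real \<Rightarrow> real \<Rightarrow> real" where
  "positive_variation f a x = (SUP S\<in>{S. interval_family a x S}. increment f S)"

context
  fixes a b :: real and f :: "real \<Rightarrow> real"
  assumes f: "absolutely_continuous_fun a b f"
begin

lemma bdd_above_increment: "x \<le> b \<Longrightarrow> bdd_above (increment f ` {S. interval_family a x S})"
proof -
  assume "x \<le> b"
  obtain B where "\<And>S. interval_family a b S \<Longrightarrow> increment f S \<le> B"
    using absolutely_continuous_fun_increment_bounded[OF f] by blast
  then show ?thesis
    using interval_family_mono[OF _ order_refl \<open>x \<le> b\<close>] by (intro bdd_aboveI2[of _ _ B]) simp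
qed

lemma increment_le_positive_variation:
  "interval_family a x S \<Longrightarrow> x \<le> b \<Longrightarrow> increment f S \<le> positive_variation f a x"
  unfolding positive_variation_def by (intro cSUP_upper bdd_above_increment) auto

lemma positive_variation_near:
  assumes "e > 0"
  obtains S where "interval_family a x S" "positive_variation f a x < increment f S + e"
proof -
  have "positive_variation f a x - e < positive_variation f a x" using assms by simp
  then obtain r where "r \<in> increment f ` {S. interval_family a x S}" "positive_variation f a x - e < r"
    unfolding positive_variation_def
    using less_cSupD[of "increment f ` {S. interval_family a x S}"] interval_family_empty by blast
  then show ?thesis using that by fastforce
qed

text \<open>
  Superadditivity; the empty family gives monotonicity of \<open>P\<close>, and the single interval
  \<open>{(x, y)}\<close> gives monotonicity of \<open>P - f\<close>.
\<close>

lemma positive_variation_add_le: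
  assumes "interval_family x y S" "a \<le> x" "x \<le> y" "y \<le> b"
  shows "positive_variation f a x + increment f S \<le> positive_variation f a y"
proof (rule field_le_epsilon)
  fix e :: real assume "e > 0"
  then obtain T where T: "interval_family a x T" "positive_variation f a x < increment f T + e"
    by (rule positive_variation_near)
  have "increment f T + increment f S \<le> positive_variation f a y"
    using increment_le_positive_variation[of y "T \<union> S"] interval_family_Un[OF T(1) assms(1)] assms by simp
  with T show "positive_variation f a x + increment f S \<le> positive_variation f a y + e" by linarith
qed

lemma positive_variation_mono:
  "a \<le> x \<Longrightarrow> x \<le> y \<Longrightarrow> y \<le> b \<Longrightarrow> positive_variation f a x \<le> positive_variation f a y"
  using positive_variation_add_le[of x y "{}"] by simp

lemma negative_variation_mono:
  assumes "a \<le> x" "x \<le> y" "y \<le> b"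
  shows "positive_variation f a x - f x \<le> positive_variation f a y - f y"
proof (cases "x = y")
  case False
  with assms show ?thesis
    using positive_variation_add_le[of x y "{(x, y)}"] interval_family_singleton[of x x y y] by simp
qed simp

text \<open>
  The converse of superadditivity, up to \<open>e\<close>: cut a family that is nearly optimal on \<open>[a, y]\<close> at
  \<open>x\<close>; its part in \<open>[a, x]\<close> contributes at most \<open>P x\<close>.
\<close>

lemma positive_variation_diff_near:
  assumes "a \<le> x" "x \<le> y" "y \<le> b" "e > 0"
  obtains S where "interval_family x y S" "positive_variation f a y - positive_variation f a x \<le> increment f S + e"
proof -
  obtain T where T: "interval_family a y T" "positive_variation f a y < increment f T + e"
    using positive_variation_near[OF \<open>e > 0\<close>] .
  obtain S1 S2 where S: "interval_family a x S1" "interval_family x y S2"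
     "\<And>f. increment f T = increment f S1 + increment f S2"
    using increment_split[OF T(1) assms(1,2)] by blast
  have "increment f S1 \<le> positive_variation f a x"
    using increment_le_positive_variation[OF S(1)] assms by linarith
  with T S show ?thesis by (intro that[of S2]) (auto simp: S(3)[of f])
qed

text \<open>
  Refine each interval of a short family \<open>S\<close> by a family that nearly realises the increment of \<open>P\<close>
  there. The refinement is still short, so its increment of \<open>f\<close> is small.
\<close>

lemma absolutely_continuous_positive_variation:
  "absolutely_continuous_fun a b (positive_variation f a)"
  unfolding absolutely_continuous_fun_iff
proof (intro allI impI)
  let ?P = "positive_variation f a"
  fix \<epsilon> :: real assume "\<epsilon> > 0"
  then obtain \<delta> where "\<delta> > 0" and \<delta>: "\<And>S. interval_family a b S \<Longrightarrow> increment (\<lambda>x. x) S < \<delta> \<Longrightarrow>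
        (\<Sum>p\<in>S. \<bar>f (snd p) - f (fst p)\<bar>) < \<epsilon>/2"
    using absolutely_continuous_funE[OF f half_gt_zero] by blast
  have "(\<Sum>p\<in>S. \<bar>?P (snd p) - ?P (fst p)\<bar>) < \<epsilon>"
    if S: "interval_family a b S" and len: "increment (\<lambda>x. x) S < \<delta>" for S
  proof -
    \<comment> \<open>The error of one approximation; the \<open>+ 1\<close> keeps it defined for empty \<open>S\<close>.\<close>
    define \<eta> where "\<eta> = \<epsilon> / (2 * (real (card S) + 1))"
    have "\<eta> > 0" using \<open>\<epsilon> > 0\<close> by (simp add: \<eta>_def add_nonneg_pos)
    have \<eta>: "real (card S) * \<eta> \<le> \<epsilon>/2" using \<open>\<epsilon> > 0\<close> by (simp add: \<eta>_def divide_simps)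
    have "\<exists>T. interval_family (fst p) (snd p) T \<and> ?P (snd p) - ?P (fst p) \<le> increment f T + \<eta>" if "p \<in> S" for p
      using positive_variation_diff_near[of "fst p" "snd p" \<eta>] interval_familyD[OF S that] \<open>\<eta> > 0\<close>
      by (metis less_imp_le)
    then obtain T where T: "\<And>p. p \<in> S \<Longrightarrow> interval_family (fst p) (snd p) (T p)"
      and PT: "\<And>p. p \<in> S \<Longrightarrow> ?P (snd p) - ?P (fst p) \<le> increment f (T p) + \<eta>"
      by metis
    note U = interval_family_UN[OF S T]
    have "increment (\<lambda>x. x) (\<Union>p\<in>S. T p) = (\<Sum>p\<in>S. increment (\<lambda>x. x) (T p))"
      by (rule U(2))
    also have "\<dots> \<le> increment (\<lambda>x. x) S"
      unfolding increment_def[of _ S]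
      using increment_id_le[OF T] interval_familyD(2)[OF S] by (intro sum_mono) (simp add: less_imp_le)
    finally have "increment f (\<Union>p\<in>S. T p) < \<epsilon>/2"
      using \<delta>[OF U(1)] increment_le_sum_abs[of f "\<Union>p\<in>S. T p"] len by linarith
    then have *: "(\<Sum>p\<in>S. increment f (T p)) < \<epsilon>/2"
      using U(2)[of f] by simp
    have "(\<Sum>p\<in>S. \<bar>?P (snd p) - ?P (fst p)\<bar>) = (\<Sum>p\<in>S. ?P (snd p) - ?P (fst p))"
      using interval_familyD[OF S] positive_variation_mono by (intro sum.cong) (auto simp: less_imp_le)
    also have "\<dots> \<le> (\<Sum>p\<in>S. increment f (T p) + \<eta>)"
      using PT by (intro sum_mono) auto
    also have "\<dots> < \<epsilon>" using * \<eta> by (simp add: sum.distrib)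
    finally show ?thesis .
  qed
  then show "\<exists>\<delta>>0. \<forall>S. interval_family a b S \<and> increment (\<lambda>x. x) S < \<delta> \<longrightarrow>
      (\<Sum>p\<in>S. \<bar>?P (snd p) - ?P (fst p)\<bar>) < \<epsilon>"
    using \<open>\<delta> > 0\<close> by blast
qed

end

section \<open>Lebesgue differentiation\<close>

text \<open>
  Let \<open>Bad c\<close> be the points of \<open>A\<close> around which arbitrarily small balls have \<open>N\<close>-measure above \<open>c\<close>
  times the radius. Enclose \<open>A\<close> in an open \<open>U\<close> with small \<open>N U\<close>. The bad balls inside \<open>U\<close> form a Vitali
  cover of \<open>Bad c\<close>, and a disjoint subfamily covering almost all of it has Lebesgue measure at most
  \<open>(2 / c) * N U\<close>.
\<close>

lemma AE_small_balls_of_null_set: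
  fixes N :: "real measure"
  assumes sets: "sets N = sets borel" and fin: "emeasure N UNIV \<noteq> \<infinity>"
    and A: "A \<in> sets borel" and null: "emeasure N A = 0"
  shows "AE x in lborel. x \<in> A \<longrightarrow>
    (\<forall>c>0. \<exists>d>0. \<forall>r. 0 < r \<and> r < d \<longrightarrow> emeasure N (cball x r) \<le> ennreal (c * r))"
proof -
  define Bad where "Bad c = {x\<in>A. \<forall>d>0. \<exists>r. 0 < r \<and> r < d \<and> ennreal (c * r) < emeasure N (cball x r)}" for c :: real
  have space: "space N = UNIV" using sets_eq_imp_space_eq[OF sets] by simp
  have "negligible (Bad c)" if "c > 0" for c
    unfolding negligible_outer_le
  proof (intro allI impI)
    fix e :: real assume "e > 0"
    have "(INF U \<in> {U. A \<subseteq> U \<and> open U}. emeasure N U) < ennreal (c / 2 * e)"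
      using outer_regular[OF sets _ A] fin null \<open>c > 0\<close> \<open>e > 0\<close> space by simp
    then obtain U where U: "A \<subseteq> U" "open U" "emeasure N U < ennreal (c / 2 * e)"
      by (auto simp: INF_less_iff)
    define K where "K = {(x, r). 0 < r \<and> cball x r \<subseteq> U \<and> ennreal (c * r) < emeasure N (cball x r)}"
    have pos: "0 < snd i" if "i \<in> K" for i using that by (auto simp: K_def)
    have cover: "\<exists>i. i \<in> K \<and> x \<in> cball (fst i) (snd i) \<and> snd i < d" if "x \<in> Bad c" "0 < d" for x d
    proof -
      have bad: "\<forall>d>0. \<exists>r. 0 < r \<and> r < d \<and> ennreal (c * r) < emeasure N (cball x r)"
        using that(1) by (simp add: Bad_def)
      have "x \<in> U" using that U(1) by (auto simp: Bad_def)
      then obtain s where "s > 0" "cball x s \<subseteq> U"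
        using U(2) by (meson open_contains_cball)
      moreover have "0 < min s d" using \<open>s > 0\<close> that(2) by simp
      then obtain r where "0 < r" "r < min s d" "ennreal (c * r) < emeasure N (cball x r)"
        using bad[rule_format, OF \<open>0 < min s d\<close>] by blast
      ultimately have "(x, r) \<in> K" unfolding K_def by fastforce
      then show ?thesis using \<open>r < min s d\<close> \<open>0 < r\<close> by (intro exI[of _ "(x, r)"]) auto
    qed
    obtain C where C: "countable C" "C \<subseteq> K"
      "pairwise (\<lambda>i j. disjnt (cball (fst i) (snd i)) (cball (fst j) (snd j))) C"
      "negligible (Bad c - (\<Union>i\<in>C. cball (fst i) (snd i)))"
      by (rule Vitali_covering_theorem_cballs[of K snd "Bad c" fst, OF pos cover])
    define W where "W = (\<Union>i\<in>C. cball (fst i) (snd i))"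
    have W [measurable]: "W \<in> sets borel"
      unfolding W_def using C(1) by (intro sets.countable_UN') auto
    have disj: "disjoint_family_on (\<lambda>i. cball (fst i) (snd i)) C"
      using C(3) by (auto simp: pairwise_def disjoint_family_on_def disjnt_def)
    have "emeasure lborel W = (\<integral>\<^sup>+i. emeasure lborel (cball (fst i) (snd i)) \<partial>count_space C)"
      unfolding W_def using C(1) disj by (intro emeasure_UN_countable) auto
    also have "\<dots> \<le> (\<integral>\<^sup>+i. ennreal (2 / c) * emeasure N (cball (fst i) (snd i)) \<partial>count_space C)"
    proof (rule nn_integral_mono)
      fix i assume "i \<in> space (count_space C)"
      then have i: "0 < snd i" "ennreal (c * snd i) < emeasure N (cball (fst i) (snd i))"
        using C(2) by (auto simp: K_def)
      have "emeasure lborel (cball (fst i) (snd i)) = ennreal (2 * snd i)"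
        using i(1) by (simp add: cball_eq_atLeastAtMost)
      also have "\<dots> = ennreal (2 / c) * ennreal (c * snd i)"
        using \<open>c > 0\<close> i(1) by (simp add: ennreal_mult[symmetric])
      also have "\<dots> \<le> ennreal (2 / c) * emeasure N (cball (fst i) (snd i))"
        using i(2) by (intro mult_left_mono) auto
      finally show "emeasure lborel (cball (fst i) (snd i)) \<le> \<dots>" .
    qed
    also have "\<dots> = ennreal (2 / c) * (\<integral>\<^sup>+i. emeasure N (cball (fst i) (snd i)) \<partial>count_space C)"
      by (rule nn_integral_cmult) simp
    also have "(\<integral>\<^sup>+i. emeasure N (cball (fst i) (snd i)) \<partial>count_space C) = emeasure N W"
      unfolding W_def using C(1) disj by (intro emeasure_UN_countable[symmetric]) (auto simp: sets)
    also have "ennreal (2 / c) * emeasure N W \<le> ennreal (2 / c) * ennreal (c / 2 * e)"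
    proof (rule mult_left_mono)
      have "W \<subseteq> U" using C(2) by (force simp: W_def K_def)
      then have "emeasure N W \<le> emeasure N U" using U(2) by (intro emeasure_mono) (auto simp: sets)
      then show "emeasure N W \<le> ennreal (c / 2 * e)" using U(3) by simp
    qed simp
    also have "\<dots> = ennreal e" using \<open>c > 0\<close> \<open>e > 0\<close> by (simp add: ennreal_mult[symmetric])
    finally have We: "emeasure lborel W \<le> ennreal e" .
    have neg: "Bad c - W \<in> null_sets lebesgue"
      using C(4) unfolding W_def negligible_iff_null_sets .
    have "emeasure lebesgue (W \<union> (Bad c - W)) = emeasure lborel W"
      by (subst emeasure_Un_null_set[OF _ neg]) auto
    with We have le: "emeasure lebesgue (W \<union> (Bad c - W)) \<le> ennreal e" by (simp only:)
    show "\<exists>T. Bad c \<subseteq> T \<and> T \<in> lmeasurable \<and> measure lebesgue T \<le> e"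
    proof (intro exI conjI)
      show "Bad c \<subseteq> W \<union> (Bad c - W)" by auto
      show "W \<union> (Bad c - W) \<in> lmeasurable"
      proof (rule fmeasurableI)
        show "W \<union> (Bad c - W) \<in> sets lebesgue" using null_setsD2[OF neg] by (intro sets.Un) auto
        show "emeasure lebesgue (W \<union> (Bad c - W)) < \<infinity>"
          using le by (rule order.strict_trans1) simp
      qed
      show "measure lebesgue (W \<union> (Bad c - W)) \<le> e"
        unfolding measure_def using le \<open>e > 0\<close> by (intro enn2real_leI) auto
    qed
  qed
  then have "negligible (\<Union>n. Bad (1 / real (Suc n)))"
    by (intro negligible_countable_Union) auto
  then have "AE x in lebesgue. x \<notin> (\<Union>n. Bad (1 / real (Suc n)))"
    unfolding negligible_iff_null_sets by (rule AE_not_in)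
  then have "AE x in lborel. x \<notin> (\<Union>n. Bad (1 / real (Suc n)))"
    by (simp only: AE_completion_iff)
  then show ?thesis
  proof (eventually_elim, intro impI allI)
    fix x c :: real assume x: "x \<notin> (\<Union>n. Bad (1 / real (Suc n)))" "x \<in> A" and "c > 0"
    obtain n where n: "1 / real (Suc n) < c"
      using \<open>c > 0\<close> reals_Archimedean by (auto simp: inverse_eq_divide)
    have "x \<notin> Bad (1 / real (Suc n))" using x(1) by blast
    then obtain d where "d > 0"
      and d': "\<And>r. \<not> (0 < r \<and> r < d \<and> ennreal (1 / real (Suc n) * r) < emeasure N (cball x r))"
      using x(2) unfolding Bad_def by blast
    have d: "emeasure N (cball x r) \<le> ennreal (1 / real (Suc n) * r)" if "0 < r" "r < d" for r
      using d'[of r] that by (simp only: not_less simp_thms)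
    have "emeasure N (cball x r) \<le> ennreal (c * r)" if "0 < r" "r < d" for r
    proof -
      have "1 / real (Suc n) * r \<le> c * r" using n that by (intro mult_right_mono) auto
      with d[OF that] show ?thesis by (meson ennreal_leI order_trans)
    qed
    with \<open>d > 0\<close> show "\<exists>d>0. \<forall>r. 0 < r \<and> r < d \<longrightarrow> emeasure N (cball x r) \<le> ennreal (c * r)"
      by blast
  qed
qed

text \<open>
  Only countably many null sets occur, as the levels \<open>q\<close> are rational. Between \<open>x\<close> and a nearby
  \<open>y\<close> the integrand is at most \<open>q + max 0 (h - q)\<close>; the second term integrates to at most
  \<open>e / 2 * \<bar>y - x\<bar>\<close> once \<open>h x \<le> q\<close>.
\<close>

lemma AE_difference_quotient_le:
  fixes h F :: "real \<Rightarrow> real"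
  assumes h: "integrable lborel h"
    and F: "\<And>x y. a \<le> x \<Longrightarrow> x \<le> y \<Longrightarrow> y \<le> b \<Longrightarrow> F y - F x = (LINT t:{x..y}|lborel. h t)"
  shows "AE x in lborel. a < x \<and> x < b \<longrightarrow>
    (\<forall>e>0. eventually (\<lambda>y. (F y - F x) / (y - x) \<le> h x + e) (at x))"
proof -
  have [measurable]: "h \<in> borel_measurable borel" using h by simp
  \<comment> \<open>The restriction to \<open>[a, b]\<close> makes the excess over a negative \<open>q\<close> integrable.\<close>
  define k where "k q t = indicator {a..b} t * max 0 (h t - q)" for q t :: real
  have k_nonneg: "0 \<le> k q t" for q t by (simp add: k_def)
  have [measurable]: "k q \<in> borel_measurable borel" for q unfolding k_def by measurable
  have k_int: "integrable lborel (k q)" for q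
  proof -
    have "integrable lborel (\<lambda>t. indicator {a..b} t * \<bar>h t\<bar> + indicator {a..b} t * \<bar>q\<bar> :: real)"
      using h integrable_mult_indicator[of "{a..b}" lborel "\<lambda>t. \<bar>h t\<bar>"]
      by (intro Bochner_Integration.integrable_add integrable_mult_left integrable_real_indicator)
        (auto simp: emeasure_lborel_Icc_eq)
    then show ?thesis
      by (rule Bochner_Integration.integrable_bound) (auto simp: k_def indicator_def)
  qed
  define N where "N q = density lborel (\<lambda>t. ennreal (k q t))" for q
  have "AE x in lborel. x \<in> {x. h x \<le> q} \<longrightarrow>
    (\<forall>c>0. \<exists>d>0. \<forall>r. 0 < r \<and> r < d \<longrightarrow> emeasure (N q) (cball x r) \<le> ennreal (c * r))" for q
  proof (rule AE_small_balls_of_null_set)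
    show "sets (N q) = sets borel" by (simp add: N_def)
    show "emeasure (N q) UNIV \<noteq> \<infinity>"
      using integrableD(2)[OF k_int[of q]] k_nonneg by (simp add: N_def emeasure_density)
    show "{x. h x \<le> q} \<in> sets borel" by measurable
    have "emeasure (N q) {x. h x \<le> q} = (\<integral>\<^sup>+t. ennreal (k q t) * indicator {x. h x \<le> q} t \<partial>lborel)"
      unfolding N_def by (rule emeasure_density) measurable
    also have "\<dots> = (\<integral>\<^sup>+(t::real). 0 \<partial>lborel)"
      by (intro nn_integral_cong) (auto simp: k_def indicator_def)
    finally show "emeasure (N q) {x. h x \<le> q} = 0" by simp
  qed
  then have "AE x in lborel. \<forall>q\<in>\<rat>. x \<in> {x. h x \<le> q} \<longrightarrow>
    (\<forall>c>0. \<exists>d>0. \<forall>r. 0 < r \<and> r < d \<longrightarrow> emeasure (N q) (cball x r) \<le> ennreal (c * r))"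
    by (intro AE_ball_countable[OF countable_rat, THEN iffD2] ballI)
  then show ?thesis
  proof (eventually_elim, intro impI allI)
    fix x e :: real
    assume N: "\<forall>q\<in>\<rat>. x \<in> {x. h x \<le> q} \<longrightarrow>
      (\<forall>c>0. \<exists>d>0. \<forall>r. 0 < r \<and> r < d \<longrightarrow> emeasure (N q) (cball x r) \<le> ennreal (c * r))"
    assume x: "a < x \<and> x < b" and "e > 0"
    obtain q where q: "q \<in> \<rat>" "h x < q" "q < h x + e / 2"
      using Rats_dense_in_real[of "h x" "h x + e / 2"] \<open>e > 0\<close> by auto
    have "e / 2 > 0" using \<open>e > 0\<close> by simp
    have "x \<in> {x. h x \<le> q}" using q by simp
    then obtain d where "d > 0" and d: "\<And>r. 0 < r \<and> r < d \<Longrightarrow> emeasure (N q) (cball x r) \<le> ennreal (e / 2 * r)"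
      using N[rule_format, OF q(1) _ \<open>e / 2 > 0\<close>] by blast
    define d' where "d' = min d (min (x - a) (b - x))"
    have "d' > 0" using \<open>d > 0\<close> x by (simp add: d'_def)
    have "(F y - F x) / (y - x) \<le> h x + e" if y: "y \<noteq> x" "dist y x < d'" for y
    proof -
      \<comment> \<open>Ordering the endpoints treats both sides of \<open>x\<close> at once.\<close>
      define s where "s = min x y"
      define t where "t = max x y"
      define r where "r = \<bar>y - x\<bar>"
      have r: "0 < r" "r < d" "t - s = r" using y by (auto simp: r_def s_def t_def d'_def dist_real_def)
      have st: "a \<le> s" "s \<le> t" "t \<le> b" using y by (auto simp: s_def t_def d'_def dist_real_def)
      have sub: "{s..t} \<subseteq> cball x r" by (auto simp: s_def t_def r_def cball_eq_atLeastAtMost)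
      have int1: "integrable lborel (\<lambda>u. indicator {s..t} u * k q u)"
        using integrable_mult_indicator[OF _ k_int, of "{s..t}" q] by simp
      have "ennreal (LINT u|lborel. indicator {s..t} u * k q u) = (\<integral>\<^sup>+u. ennreal (indicator {s..t} u * k q u) \<partial>lborel)"
        using int1 k_nonneg by (intro nn_integral_eq_integral[symmetric]) auto
      also have "\<dots> \<le> (\<integral>\<^sup>+u. ennreal (k q u) * indicator (cball x r) u \<partial>lborel)"
        using sub by (intro nn_integral_mono) (auto simp: indicator_def)
      also have "\<dots> = emeasure (N q) (cball x r)"
        unfolding N_def by (intro emeasure_density[symmetric]) auto
      also have "\<dots> \<le> ennreal (e / 2 * r)" using d r by blast
      finally have k_le: "(LINT u|lborel. indicator {s..t} u * k q u) \<le> e / 2 * r"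
        using \<open>e > 0\<close> r by (simp add: ennreal_le_iff)
      have int2: "integrable lborel (\<lambda>u. q * indicator {s..t} u)"
        by (intro integrable_mult_right integrable_real_indicator) (auto simp: emeasure_lborel_Icc_eq)
      have "F t - F s = (LINT u|lborel. indicator {s..t} u * h u)"
        using F[OF st] by (simp add: set_lebesgue_integral_def)
      also have "\<dots> \<le> (LINT u|lborel. q * indicator {s..t} u + indicator {s..t} u * k q u)"
        using integrable_mult_indicator[OF _ h, of "{s..t}"] int1 int2 st
        by (intro integral_mono integrable_add) (auto simp: indicator_def k_def)
      also have "\<dots> = q * r + (LINT u|lborel. indicator {s..t} u * k q u)"
        using int1 int2 r st by simp
      also have "\<dots> \<le> (h x + e) * r"
      proof -
        have "q * r \<le> (h x + e / 2) * r" using q r by (intro mult_right_mono) auto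
        with k_le show ?thesis by (simp add: algebra_simps)
      qed
      finally have "(F t - F s) / r \<le> h x + e" using r by (simp add: divide_le_eq)
      moreover have "(F t - F s) / r = (F y - F x) / (y - x)"
        using y by (auto simp: s_def t_def r_def min_def max_def divide_simps algebra_simps)
      ultimately show ?thesis by simp
    qed
    with \<open>d' > 0\<close> show "eventually (\<lambda>y. (F y - F x) / (y - x) \<le> h x + e) (at x)"
      unfolding eventually_at by blast
  qed
qed

theorem AE_has_real_derivative_of_indefinite_integral:
  fixes h F :: "real \<Rightarrow> real"
  assumes h: "integrable lborel h"
    and F: "\<And>x y. a \<le> x \<Longrightarrow> x \<le> y \<Longrightarrow> y \<le> b \<Longrightarrow> F y - F x = (LINT t:{x..y}|lborel. h t)"
  shows "AE x in lborel. a < x \<and> x < b \<longrightarrow> (F has_real_derivative h x) (at x)"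
proof -
  have F': "- F y - - F x = (LINT t:{x..y}|lborel. - h t)" if "a \<le> x" "x \<le> y" "y \<le> b" for x y
    using F[OF that] by (simp add: set_lebesgue_integral_def)
  have "integrable lborel (\<lambda>t. - h t)" using h by simp
  then have lower: "AE x in lborel. a < x \<and> x < b \<longrightarrow>
      (\<forall>e>0. eventually (\<lambda>y. (- F y - - F x) / (y - x) \<le> - h x + e) (at x))"
    using F' by (rule AE_difference_quotient_le)
  have upper: "AE x in lborel. a < x \<and> x < b \<longrightarrow>
      (\<forall>e>0. eventually (\<lambda>y. (F y - F x) / (y - x) \<le> h x + e) (at x))"
    using h F by (rule AE_difference_quotient_le)
  from upper lower show ?thesis
  proof (eventually_elim, intro impI)
    fix x
    assume up: "a < x \<and> x < b \<longrightarrow> (\<forall>e>0. eventually (\<lambda>y. (F y - F x) / (y - x) \<le> h x + e) (at x))"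
      and lo: "a < x \<and> x < b \<longrightarrow> (\<forall>e>0. eventually (\<lambda>y. (- F y - - F x) / (y - x) \<le> - h x + e) (at x))"
      and x: "a < x \<and> x < b"
    have "((\<lambda>y. (F y - F x) / (y - x)) \<longlongrightarrow> h x) (at x)"
    proof (rule tendstoI)
      fix e :: real assume "e > 0"
      then have "eventually (\<lambda>y. (F y - F x) / (y - x) \<le> h x + e / 2) (at x)"
        "eventually (\<lambda>y. (- F y - - F x) / (y - x) \<le> - h x + e / 2) (at x)"
        using up lo x half_gt_zero by blast+
      then show "eventually (\<lambda>y. dist ((F y - F x) / (y - x)) (h x) < e) (at x)"
      proof eventually_elim
        case (elim y)
        have "(- F y - - F x) / (y - x) = - ((F y - F x) / (y - x))"
          by (simp add: minus_divide_left)
        with elim \<open>e > 0\<close> show ?case unfolding dist_real_def by linarith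
      qed
    qed
    then show "(F has_real_derivative h x) (at x)"
      by (simp add: has_field_derivative_iff)
  qed
qed

section \<open>Absolutely continuous functions as indefinite integrals\<close>

lemma absolutely_continuous_fun_continuous_on:
  assumes P: "absolutely_continuous_fun a b P"
  shows "continuous_on {a..b} P"
  unfolding continuous_on_iff
proof (intro ballI allI impI)
  fix x e :: real assume x: "x \<in> {a..b}" and "e > 0"
  obtain \<delta> where "\<delta> > 0" and \<delta>: "\<And>S. interval_family a b S \<Longrightarrow> increment (\<lambda>x. x) S < \<delta> \<Longrightarrow>
      (\<Sum>p\<in>S. \<bar>P (snd p) - P (fst p)\<bar>) < e"
    using absolutely_continuous_funE[OF P \<open>e > 0\<close>] by blast
  have near: "dist (P u) (P v) < e" if "a \<le> u" "u < v" "v \<le> b" "v - u < \<delta>" for u v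
    using \<delta>[of "{(u, v)}"] that
    by (simp add: interval_family_singleton dist_real_def abs_minus_commute)
  have "dist (P y) (P x) < e" if "y \<in> {a..b}" "dist y x < \<delta>" for y
    using that x \<open>e > 0\<close> near[of x y] near[of y x]
    by (cases y x rule: linorder_cases) (auto simp: dist_real_def abs_minus_commute)
  with \<open>\<delta> > 0\<close> show "\<exists>d>0. \<forall>y\<in>{a..b}. dist y x < d \<longrightarrow> dist (P y) (P x) < e" by blast
qed

text \<open>
  Dyadic subdivision of \<open>[a, b]\<close>, stopped as soon as a piece that meets \<open>B\<close> lies in \<open>T\<close>: this is
  \<open>covering_lemma\<close> for a gauge equal to \<open>T\<close> on \<open>B\<close>. The result is stated for sets of endpoint pairs, whose finite subsets can be fed into the definition of absolute continuity.
\<close>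

lemma countable_interval_cover:
  fixes a b :: real
  assumes "a < b" and T: "open T" and B: "B \<subseteq> T" "B \<subseteq> {a..b}"
  obtains S where "countable S" "\<And>R. finite R \<Longrightarrow> R \<subseteq> S \<Longrightarrow> interval_family a b R"
    "\<And>p. p \<in> S \<Longrightarrow> {fst p..snd p} \<subseteq> T" "B \<subseteq> (\<Union>p\<in>S. {fst p..snd p})"
proof -
  define g where "g x = (if x \<in> T then T else UNIV)" for x
  have "gauge g" using T by (auto simp: gauge_def g_def)
  have "B \<subseteq> cbox a b" "box a b \<noteq> {}" using B(2) \<open>a < b\<close> by (auto simp: box_eq_empty)
  then show thesis
  proof (rule covering_lemma[OF _ _ \<open>gauge g\<close>])
    fix D assume D: "countable D" "\<Union>D \<subseteq> cbox a b"
      and cbox: "\<And>K. K \<in> D \<Longrightarrow> interior K \<noteq> {} \<and> (\<exists>c d. K = cbox c d)"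
      and disj: "pairwise (\<lambda>A B. interior A \<inter> interior B = {}) D"
      and fine: "\<And>K. K \<in> D \<Longrightarrow> \<exists>x \<in> B \<inter> K. K \<subseteq> g x"
      and cover: "B \<subseteq> \<Union>D"
    define ends where "ends K = (Inf K, Sup K)" for K :: "real set"
    have ends: "a \<le> fst (ends K) \<and> fst (ends K) < snd (ends K) \<and> snd (ends K) \<le> b
        \<and> {fst (ends K)..snd (ends K)} = K" if "K \<in> D" for K
    proof -
      obtain c d where K: "K = {c..d}" using cbox[OF \<open>K \<in> D\<close>] by auto
      then have "c < d" using cbox[OF \<open>K \<in> D\<close>] by auto
      moreover have "K \<subseteq> {a..b}" using D(2) \<open>K \<in> D\<close> by auto
      ultimately show ?thesis using K by (auto simp: ends_def)
    qed
    show thesis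
    proof (rule that[of "ends ` D"])
      show "countable (ends ` D)" using D(1) by simp
      show "interval_family a b R" if R: "finite R" "R \<subseteq> ends ` D" for R
        unfolding interval_family_def
      proof (intro conjI ballI pairwiseI)
        show "finite R" by (rule R(1))
        fix p assume "p \<in> R"
        then obtain K where K: "K \<in> D" "p = ends K" using R(2) by blast
        then show "a \<le> fst p" "fst p < snd p" "snd p \<le> b" using ends[OF K(1)] by simp_all
        fix q assume "q \<in> R" "p \<noteq> q"
        then obtain L where L: "L \<in> D" "q = ends L" using R(2) by blast
        with K(2) \<open>p \<noteq> q\<close> have "K \<noteq> L" by blast
        then have "interior K \<inter> interior L = {}"
          by (rule pairwiseD[OF disj K(1) L(1)])
        moreover have "interior K = {fst p<..<snd p}" "interior L = {fst q<..<snd q}"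
          using interior_atLeastAtMost_real[of "fst p" "snd p"] interior_atLeastAtMost_real[of "fst q" "snd q"]
            ends[OF K(1)] ends[OF L(1)] K(2) L(2) by simp_all
        ultimately show "disjnt {fst p<..<snd p} {fst q<..<snd q}"
          by (simp only: disjnt_def)
      qed
      show "{fst p..snd p} \<subseteq> T" if "p \<in> ends ` D" for p
      proof -
        obtain K where K: "K \<in> D" "p = ends K" using \<open>p \<in> ends ` D\<close> by blast
        from fine[OF K(1)] obtain x where x: "x \<in> B \<inter> K" "K \<subseteq> g x" by (rule bexE)
        then have "K \<subseteq> T" using B(1) by (auto simp: g_def split: if_splits)
        then show ?thesis using ends[OF K(1)] K(2) by simp
      qed
      show "B \<subseteq> (\<Union>p\<in>ends ` D. {fst p..snd p})" using cover ends by simp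
    qed
  qed
qed

text \<open>
  Cover \<open>B\<close> by nonoverlapping intervals inside an open set of Lebesgue measure below \<open>\<delta>\<close>. Every finite
  subfamily has total length below \<open>\<delta>\<close>, hence \<open>\<mu>\<close>-measure at most \<open>\<epsilon>\<close>, and so has the countable union by
  continuity from below.
\<close>

lemma absolutely_continuous_mono_null_set:
  fixes \<mu> :: "real measure"
  assumes "a < b" and P: "absolutely_continuous_fun a b P"
    and sets: "sets \<mu> = sets borel"
    and \<mu>: "\<And>u v. a \<le> u \<Longrightarrow> u \<le> v \<Longrightarrow> v \<le> b \<Longrightarrow> emeasure \<mu> {u..v} = ennreal (P v - P u)"
    and B: "B \<in> null_sets lborel" "B \<subseteq> {a..b}"
  shows "emeasure \<mu> B = 0"
proof -
  have small: "emeasure \<mu> B \<le> ennreal \<epsilon>" if "\<epsilon> > 0" for \<epsilon>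
  proof -
    obtain \<delta> where "\<delta> > 0" and \<delta>: "\<And>S. interval_family a b S \<Longrightarrow> increment (\<lambda>x. x) S < \<delta> \<Longrightarrow>
        (\<Sum>p\<in>S. \<bar>P (snd p) - P (fst p)\<bar>) < \<epsilon>"
      using absolutely_continuous_funE[OF P \<open>\<epsilon> > 0\<close>] by blast
    have "B \<in> sets lebesgue" using B(1) by auto
    then obtain T where T: "open T" "B \<subseteq> T" "T - B \<in> lmeasurable"
        "emeasure lebesgue (T - B) < ennreal \<delta>"
      by (rule sets_lebesgue_outer_open[OF _ \<open>\<delta> > 0\<close>])
    have T_lt: "emeasure lborel T < ennreal \<delta>"
    proof -
      have "emeasure lborel T = emeasure lborel (T - B)"
        using B(1) T(1) by (intro emeasure_Diff_null_set[symmetric]) auto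
      also have "\<dots> = emeasure lebesgue (T - B)"
        using B(1) T(1) by auto
      finally show ?thesis using T(4) by simp
    qed
    obtain S where S: "countable S" "\<And>R. finite R \<Longrightarrow> R \<subseteq> S \<Longrightarrow> interval_family a b R"
      "\<And>p. p \<in> S \<Longrightarrow> {fst p..snd p} \<subseteq> T" "B \<subseteq> (\<Union>p\<in>S. {fst p..snd p})"
      using countable_interval_cover[OF \<open>a < b\<close> T(1,2) B(2)] by blast
    have fin: "emeasure \<mu> (\<Union>p\<in>R. {fst p..snd p}) \<le> ennreal \<epsilon>" if R: "finite R" "R \<subseteq> S" for R
    proof -
      note fam = S(2)[OF R]
      have "increment (\<lambda>x. x) R \<le> measure lborel T"
        unfolding increment_id_eq_measure[OF fam]
      proof (rule measure_mono_fmeasurable)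
        have "{fst p<..<snd p} \<subseteq> T" if "p \<in> R" for p
        proof -
          have "p \<in> S" using R(2) that by (rule subsetD)
          have "{fst p<..<snd p} \<subseteq> {fst p..snd p}" by auto
          also have "\<dots> \<subseteq> T" by (rule S(3)[OF \<open>p \<in> S\<close>])
          finally show ?thesis .
        qed
        then show "(\<Union>p\<in>R. {fst p<..<snd p}) \<subseteq> T" by (rule UN_least)
        show "T \<in> fmeasurable lborel"
          using T(1) T_lt by (intro fmeasurableI) (auto intro: less_trans)
      qed (auto simp: open_UN borel_open)
      also have "measure lborel T < \<delta>"
        unfolding measure_def using T_lt \<open>\<delta> > 0\<close>
        by (subst enn2real_less_iff) (auto intro: less_trans)
      finally have sum: "(\<Sum>p\<in>R. \<bar>P (snd p) - P (fst p)\<bar>) < \<epsilon>" by (rule \<delta>[OF fam])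
      have "emeasure \<mu> (\<Union>p\<in>R. {fst p..snd p}) \<le> (\<Sum>p\<in>R. emeasure \<mu> {fst p..snd p})"
        by (rule emeasure_subadditive_finite[OF R(1)]) (auto simp: sets)
      also have "\<dots> \<le> (\<Sum>p\<in>R. ennreal \<bar>P (snd p) - P (fst p)\<bar>)"
      proof (rule sum_mono)
        fix p assume "p \<in> R"
        from interval_familyD[OF fam this]
        have "emeasure \<mu> {fst p..snd p} = ennreal (P (snd p) - P (fst p))" by (intro \<mu>) auto
        then show "emeasure \<mu> {fst p..snd p} \<le> ennreal \<bar>P (snd p) - P (fst p)\<bar>"
          by (simp add: ennreal_leI)
      qed
      also have "\<dots> = ennreal (\<Sum>p\<in>R. \<bar>P (snd p) - P (fst p)\<bar>)" by (simp add: sum_ennreal)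
      also have "\<dots> \<le> ennreal \<epsilon>" using sum by (intro ennreal_leI) simp
      finally show ?thesis .
    qed
    have meas: "(\<Union>p\<in>R. {fst p..snd p}) \<in> sets \<mu>" if "R \<subseteq> S" for R
      unfolding sets using countable_subset[OF that S(1)] by (intro sets.countable_UN') auto
    have "emeasure \<mu> (\<Union>p\<in>S. {fst p..snd p}) \<le> ennreal \<epsilon>"
    proof (cases "S = {}")
      case False
      define R where "R n = from_nat_into S ` {..n}" for n
      have R: "finite (R n)" "R n \<subseteq> S" for n
        using from_nat_into[OF False] by (auto simp: R_def)
      have "S = (\<Union>n. R n)"
      proof
        show "S \<subseteq> (\<Union>n. R n)"
        proof
          fix p assume "p \<in> S"
          then obtain n where "p = from_nat_into S n"
            using range_from_nat_into[OF False S(1)] by blast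
          then show "p \<in> (\<Union>n. R n)" by (auto simp: R_def)
        qed
      qed (use R(2) in blast)
      then have "(\<Union>p\<in>S. {fst p..snd p}) = (\<Union>n. \<Union>p\<in>R n. {fst p..snd p})"
        by (simp only: UN_UN_flatten)
      moreover have "incseq (\<lambda>n. \<Union>p\<in>R n. {fst p..snd p})"
        by (intro incseq_SucI UN_mono) (auto simp: R_def)
      ultimately have "emeasure \<mu> (\<Union>p\<in>S. {fst p..snd p}) = (SUP n. emeasure \<mu> (\<Union>p\<in>R n. {fst p..snd p}))"
        using SUP_emeasure_incseq[of "\<lambda>n. \<Union>p\<in>R n. {fst p..snd p}" \<mu>] meas[OF R(2)] by (simp add: image_subset_iff)
      also have "\<dots> \<le> ennreal \<epsilon>" by (intro SUP_least fin R)
      finally show ?thesis .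
    qed simp
    moreover have "emeasure \<mu> B \<le> emeasure \<mu> (\<Union>p\<in>S. {fst p..snd p})"
      by (intro emeasure_mono S(4) meas order_refl)
    ultimately show ?thesis by (rule order_trans[rotated])
  qed
  have "emeasure \<mu> B \<le> 0" by (rule ennreal_le_epsilon) (simp add: small)
  then show ?thesis by simp
qed

text \<open>
  The Radon-Nikodym density of the Stieltjes measure of \<open>P\<close>. Freezing \<open>P\<close> outside \<open>[a, b]\<close> gives a
  monotone continuous function on the line, as the Stieltjes construction requires.
\<close>

lemma absolutely_continuous_mono_is_indefinite_integral:
  assumes "a < b" and P: "absolutely_continuous_fun a b P"
    and mono: "\<And>u v. a \<le> u \<Longrightarrow> u \<le> v \<Longrightarrow> v \<le> b \<Longrightarrow> P u \<le> P v"
  obtains h where "integrable lborel h"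
    "\<And>x y. a \<le> x \<Longrightarrow> x \<le> y \<Longrightarrow> y \<le> b \<Longrightarrow> P y - P x = (LINT t:{x..y}|lborel. h t)"
proof -
  define G where "G x = P (max a (min b x))" for x
  have G_mono: "G x \<le> G y" if "x \<le> y" for x y
    unfolding G_def using that \<open>a < b\<close> by (intro mono) auto
  have "continuous_on UNIV (\<lambda>x. P (max a (min b x)))"
    using \<open>a < b\<close> by (intro continuous_on_compose2[OF absolutely_continuous_fun_continuous_on[OF P]] continuous_intros) auto
  then have G_cont: "continuous_on UNIV G" by (simp add: G_def[abs_def])
  define \<mu> where "\<mu> = interval_measure G"
  have sets_\<mu> [measurable_cong, simp]: "sets \<mu> = sets borel" by (simp add: \<mu>_def)
  have \<mu>: "emeasure \<mu> {u..v} = ennreal (P v - P u)" if "a \<le> u" "u \<le> v" "v \<le> b" for u v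
    using emeasure_interval_measure_Icc[OF that(2) G_mono G_cont] that by (simp add: \<mu>_def G_def)
  \<comment> \<open>\<open>\<mu>\<close> has no mass outside \<open>[a, b]\<close>; restricting it makes this immediate.\<close>
  define N where "N = density \<mu> (indicator {a..b})"
  have N: "emeasure N A = emeasure \<mu> (A \<inter> {a..b})" if "A \<in> sets borel" for A
  proof -
    have "emeasure N A = (\<integral>\<^sup>+t. indicator {a..b} t * indicator A t \<partial>\<mu>)"
      unfolding N_def using that by (intro emeasure_density) auto
    also have "\<dots> = (\<integral>\<^sup>+t. indicator (A \<inter> {a..b}) t \<partial>\<mu>)"
      by (intro nn_integral_cong) (auto simp: indicator_def)
    also have "\<dots> = emeasure \<mu> (A \<inter> {a..b})"
      using that by (intro nn_integral_indicator) auto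
    finally show ?thesis .
  qed
  have N_Icc: "emeasure N {u..v} = ennreal (P v - P u)" if "a \<le> u" "u \<le> v" "v \<le> b" for u v
  proof -
    have "{u..v} \<inter> {a..b} = {u..v}" using that by auto
    with N[of "{u..v}"] have "emeasure N {u..v} = emeasure \<mu> {u..v}" by (simp only: borel_closed[OF closed_atLeastAtMost])
    then show ?thesis using \<mu>[OF that] by (rule trans)
  qed
  have "absolutely_continuous lborel N"
    unfolding absolutely_continuous_def
  proof
    fix A :: "real set" assume A: "A \<in> null_sets lborel"
    then have [measurable]: "A \<in> sets borel" by auto
    have "A \<inter> {a..b} \<in> null_sets lborel" using A by (intro null_set_Int2) auto
    then have "emeasure \<mu> (A \<inter> {a..b}) = 0"
      using absolutely_continuous_mono_null_set[OF \<open>a < b\<close> P sets_\<mu> \<mu>] by blast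
    then show "A \<in> null_sets N" using N[of A] by (auto simp: null_sets_def N_def)
  qed
  moreover have "sets N = sets lborel" by (simp add: N_def)
  ultimately obtain f where f: "f \<in> borel_measurable lborel" "density lborel f = N"
    using sigma_finite_measure.Radon_Nikodym[OF sigma_finite_lborel] by blast
  have [measurable]: "f \<in> borel_measurable borel" using f(1) by simp
  have f_Icc: "(\<integral>\<^sup>+t. f t * indicator A t \<partial>lborel) = emeasure N A" if "A \<in> sets borel" for A
    using that f by (metis emeasure_density sets_lborel)
  have fin: "(\<integral>\<^sup>+t. f t \<partial>lborel) = ennreal (P b - P a)"
    using f_Icc[of UNIV] N[of UNIV] \<mu>[of a b] \<open>a < b\<close> by simp
  then have ae: "AE t in lborel. f t \<noteq> \<infinity>"
    by (intro nn_integral_PInf_AE) auto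
  have AE_eq: "AE t in lborel. ennreal (enn2real (f t)) = f t"
    using ae by eventually_elim (simp add: less_top)
  have I: "has_bochner_integral lborel (\<lambda>t. enn2real (f t) * indicator A t) c"
    if A: "A \<in> sets borel" and c: "emeasure N A = ennreal c" "0 \<le> c" for A c
  proof (rule has_bochner_integral_nn_integral)
    have "(\<integral>\<^sup>+t. ennreal (enn2real (f t) * indicator A t) \<partial>lborel) = (\<integral>\<^sup>+t. f t * indicator A t \<partial>lborel)"
      using AE_eq by (intro nn_integral_cong_AE) (auto simp: indicator_def elim: eventually_mono)
    then show "(\<integral>\<^sup>+t. ennreal (enn2real (f t) * indicator A t) \<partial>lborel) = ennreal c"
      using f_Icc[OF A] c by simp
  qed (use A c in auto)
  show thesis
  proof (rule that)
    have "emeasure N UNIV = ennreal (P b - P a)" using f_Icc[of UNIV] fin by simp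
    then show "integrable lborel (\<lambda>t. enn2real (f t))"
      using I[of UNIV "P b - P a"] mono[of a b] \<open>a < b\<close> by (auto simp: has_bochner_integral_iff)
  next
    fix x y assume "a \<le> x" "x \<le> y" "y \<le> b"
    then have "has_bochner_integral lborel (\<lambda>t. enn2real (f t) * indicator {x..y} t) (P y - P x)"
      using N_Icc mono[of x y] by (intro I) auto
    then show "P y - P x = (LINT t:{x..y}|lborel. enn2real (f t))"
      by (simp add: has_bochner_integral_iff set_lebesgue_integral_def mult.commute)
  qed
qed

lemma absolutely_continuous_is_indefinite_integral:
  assumes "a < b" and f: "absolutely_continuous_fun a b f"
  obtains h where "integrable lborel h"
    "\<And>x y. a \<le> x \<Longrightarrow> x \<le> y \<Longrightarrow> y \<le> b \<Longrightarrow> f y - f x = (LINT t:{x..y}|lborel. h t)"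
proof -
  let ?P = "positive_variation f a"
  have P: "absolutely_continuous_fun a b ?P"
    by (rule absolutely_continuous_positive_variation[OF f])
  obtain h1 where h1: "integrable lborel h1"
    "\<And>x y. a \<le> x \<Longrightarrow> x \<le> y \<Longrightarrow> y \<le> b \<Longrightarrow> ?P y - ?P x = (LINT t:{x..y}|lborel. h1 t)"
    using absolutely_continuous_mono_is_indefinite_integral[OF \<open>a < b\<close> P positive_variation_mono[OF f]] by blast
  obtain h2 where h2: "integrable lborel h2"
    "\<And>x y. a \<le> x \<Longrightarrow> x \<le> y \<Longrightarrow> y \<le> b \<Longrightarrow> (?P y - f y) - (?P x - f x) = (LINT t:{x..y}|lborel. h2 t)"
    using absolutely_continuous_mono_is_indefinite_integral[OF \<open>a < b\<close>
        absolutely_continuous_fun_diff[OF P f] negative_variation_mono[OF f]] by blast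
  show thesis
  proof (rule that)
    show "integrable lborel (\<lambda>t. h1 t - h2 t)" using h1 h2 by simp
    fix x y assume xy: "a \<le> x" "x \<le> y" "y \<le> b"
    have "set_integrable lborel {x..y} h1" "set_integrable lborel {x..y} h2"
      unfolding set_integrable_def
      by (intro integrable_mult_indicator h1(1) h2(1); simp)+
    then have "(LINT t:{x..y}|lborel. h1 t - h2 t) = (?P y - ?P x) - ((?P y - f y) - (?P x - f x))"
      using h1(2)[OF xy] h2(2)[OF xy] by (simp add: set_integral_diff)
    then show "f y - f x = (LINT t:{x..y}|lborel. h1 t - h2 t)" by simp
  qed
qed

text \<open>
  The density \<open>h\<close> is Borel measurable, while \<open>deriv f\<close> agrees with it only off a null set. Integrability
  and the value of the integral are therefore carried over from \<open>h\<close> by changing the integrand on that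
  null set.
\<close>

theorem theorem1p1:
  fixes a b :: real and f :: "real \<Rightarrow> real"
  assumes "a < b" and "absolutely_continuous_fun a b f"
  shows "(AE x\<in>{a..b} in lebesgue. f differentiable (at x)) \<and>
    set_integrable lebesgue {a..b} (deriv f) \<and>
    f b - f a = (LINT x:{a..b}|lebesgue. deriv f x)"
proof -
  obtain h where h: "integrable lborel h"
    and f: "\<And>x y. a \<le> x \<Longrightarrow> x \<le> y \<Longrightarrow> y \<le> b \<Longrightarrow> f y - f x = (LINT t:{x..y}|lborel. h t)"
    using absolutely_continuous_is_indefinite_integral[OF assms] by blast
  have "AE x in lborel. a < x \<and> x < b \<longrightarrow> (f has_real_derivative h x) (at x)"
    using AE_has_real_derivative_of_indefinite_integral[of h a b f, OF h f] by blast
  then have "AE x in lborel. x \<in> {a..b} \<longrightarrow> (f has_real_derivative h x) (at x)"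
    using AE_lborel_singleton[of a] AE_lborel_singleton[of b] by eventually_elim auto
  then have D: "AE x in lebesgue. x \<in> {a..b} \<longrightarrow> (f has_real_derivative h x) (at x)"
    by (rule AE_completion)
  then obtain Z where Z: "negligible Z" "\<And>x. x \<in> {a..b} - Z \<Longrightarrow> (f has_real_derivative h x) (at x)"
    unfolding negligible_iff_null_sets by (auto elim!: AE_E3)
  have deriv: "deriv f x = h x" if "x \<in> {a..b} - Z" for x
    using Z(2)[OF that] by (rule DERIV_imp_deriv)
  have h_int: "h absolutely_integrable_on {a..b}"
    using h unfolding set_integrable_def
    by (intro integrable_mult_indicator) (auto simp: integrable_completion)
  have deriv_int: "deriv f absolutely_integrable_on {a..b}"
    using absolutely_integrable_spike[OF h_int Z(1) deriv] .
  have "f b - f a = (LINT t:{a..b}|lborel. h t)" using f \<open>a < b\<close> by simp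
  also have "\<dots> = (LINT t:{a..b}|lebesgue. h t)"
    using h unfolding set_lebesgue_integral_def by (intro integral_completion[symmetric]) auto
  also have "\<dots> = integral {a..b} h" by (rule set_lebesgue_integral_eq_integral(2)[OF h_int])
  also have "\<dots> = integral {a..b} (deriv f)" using Z(1) deriv by (rule integral_spike)
  also have "\<dots> = (LINT x:{a..b}|lebesgue. deriv f x)"
    by (rule set_lebesgue_integral_eq_integral(2)[OF deriv_int, symmetric])
  finally have "f b - f a = (LINT x:{a..b}|lebesgue. deriv f x)" .
  moreover have "AE x\<in>{a..b} in lebesgue. f differentiable (at x)"
    using D by eventually_elim (auto simp: real_differentiable_def)
  ultimately show ?thesis using deriv_int by blast
qed

end
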